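(* Let $\rho_n,\rho_m>0$, $R_0>0$, $\epsilon_0=2^{R_0}-1$, and $0<\eta\le1$. Let $h_n,h_m$ be independent random variables, each distributed as $\mathcal{CN}(0,1)$, and let $R_n^*$ and $R_n^{\mathrm{OMA}}$ be the (random) hybrid NOMA and OMA data rates of user $U_n$ defined in the context. Then the probability $P_n^w=\Pr\left(R_n^*\le R_n^{\mathrm{OMA}}\right)$ equals $$P_n^w=1-e^{-\frac{(2-\eta)\epsilon_0}{\eta\rho_m}-\frac{4(1-\eta)}{\eta^2\rho_n}}-\int_{\frac{\epsilon_0}{\eta\rho_m}}^{\frac{(2-\eta)\epsilon_0}{\eta\rho_m}}e^{-y}\,e^{-\frac{\left(\frac{\rho_m}{\epsilon_0}y-1\right)^2}{\rho_n\left(\frac{\eta\rho_m}{\epsilon_0}y-1\right)}}\,dy .$$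
   Context: Here $\log$ is the logarithm to base 2, and $\mathcal{CN}(0,1)$ is the circularly symmetric complex Gaussian distribution with mean $0$ and variance $1$, so that $|h_n|^2$ and $|h_m|^2$ are exponentially distributed with density $e^{-x}$ on $[0,\infty)$. Define $\tau_m=\max\{0,\ \rho_m|h_m|^2/\epsilon_0-1\}$, $$R_n^{\mathrm{OMA}}=\log\left(1+\rho_n|h_n|^2\right),$$ $$R_n^*=\max\left\{\log\left(1+\beta_1\rho_n|h_n|^2\right)+\log\left(1+\beta_2\rho_n|h_n|^2\right):\ \beta_1,\beta_2\in[0,1],\ \beta_1+\beta_2\le\eta,\ \beta_1\rho_n|h_n|^2\le\tau_m\right\}.$$ These are the rate of user $U_n$ in OMA (orthogonal multiple access) with full power $\rho_n$, and its maximal rate in hybrid NOMA (non-orthogonal multiple access), where $U_n$ uses power $\beta_1\rho_n$ in the other user's slot and $\beta_2\rho_n$ in its own slot. *)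

theory Defs
  imports "HOL-Probability.Probability"
begin

text \<open>
  Density, with respect to Lebesgue measure on the complex plane, of the circularly symmetric
  complex Gaussian distribution with mean \<open>\<mu>\<close> and variance \<open>\<sigma>\<^sup>2 = E \<bar>Z - \<mu>\<bar>\<^sup>2\<close>.
  As for \<^const>\<open>normal_density\<close>, the second parameter is the standard deviation.
\<close>

definition complex_normal_density :: "complex \<Rightarrow> real \<Rightarrow> complex \<Rightarrow> real" where
  "complex_normal_density \<mu> \<sigma> z = 1 / (pi * \<sigma>\<^sup>2) * exp (- (cmod (z - \<mu>))\<^sup>2 / \<sigma>\<^sup>2)"

text \<open>
  Equivalently, real and imaginary parts are independent real Gaussians of variance \<open>\<sigma>\<^sup>2 / 2\<close>.
\<close>

lemma complex_normal_density_eq_normal_density: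
  assumes "\<sigma> > 0"
  shows "complex_normal_density \<mu> \<sigma> z =
    normal_density (Re \<mu>) (\<sigma> / sqrt 2) (Re z) * normal_density (Im \<mu>) (\<sigma> / sqrt 2) (Im z)"
proof -
  have "normal_density (Re \<mu>) (\<sigma> / sqrt 2) (Re z) * normal_density (Im \<mu>) (\<sigma> / sqrt 2) (Im z)
      = 1 / (sqrt (pi * \<sigma>\<^sup>2) * sqrt (pi * \<sigma>\<^sup>2))
        * exp (- (Re z - Re \<mu>)\<^sup>2 / \<sigma>\<^sup>2 + - (Im z - Im \<mu>)\<^sup>2 / \<sigma>\<^sup>2)"
    unfolding normal_density_def exp_add by (simp add: power_divide)
  also have "sqrt (pi * \<sigma>\<^sup>2) * sqrt (pi * \<sigma>\<^sup>2) = pi * \<sigma>\<^sup>2"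
    by simp
  also have "- (Re z - Re \<mu>)\<^sup>2 / \<sigma>\<^sup>2 + - (Im z - Im \<mu>)\<^sup>2 / \<sigma>\<^sup>2 = - (cmod (z - \<mu>))\<^sup>2 / \<sigma>\<^sup>2"
    by (simp add: cmod_power2 diff_divide_distrib)
  finally show ?thesis
    by (simp add: complex_normal_density_def)
qed

definition tau :: "real \<Rightarrow> real \<Rightarrow> complex \<Rightarrow> real" where
  "tau \<rho>\<^sub>m \<epsilon>\<^sub>0 h\<^sub>m = max 0 (\<rho>\<^sub>m * (cmod h\<^sub>m)\<^sup>2 / \<epsilon>\<^sub>0 - 1)"

definition R_OMA :: "real \<Rightarrow> complex \<Rightarrow> real" where
  "R_OMA \<rho>\<^sub>n h\<^sub>n = log 2 (1 + \<rho>\<^sub>n * (cmod h\<^sub>n)\<^sup>2)"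

definition hybrid_powers :: "real \<Rightarrow> real \<Rightarrow> real \<Rightarrow> real \<Rightarrow> complex \<Rightarrow> complex \<Rightarrow> (real \<times> real) set" where
  "hybrid_powers \<eta> \<rho>\<^sub>n \<rho>\<^sub>m \<epsilon>\<^sub>0 h\<^sub>n h\<^sub>m =
    {(\<beta>\<^sub>1, \<beta>\<^sub>2). \<beta>\<^sub>1 \<in> {0..1} \<and> \<beta>\<^sub>2 \<in> {0..1} \<and> \<beta>\<^sub>1 + \<beta>\<^sub>2 \<le> \<eta> \<and>
       \<beta>\<^sub>1 * \<rho>\<^sub>n * (cmod h\<^sub>n)\<^sup>2 \<le> tau \<rho>\<^sub>m \<epsilon>\<^sub>0 h\<^sub>m}"

definition hybrid_rate :: "real \<Rightarrow> complex \<Rightarrow> real \<times> real \<Rightarrow> real" where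
  "hybrid_rate \<rho>\<^sub>n h\<^sub>n = (\<lambda>(\<beta>\<^sub>1, \<beta>\<^sub>2).
     log 2 (1 + \<beta>\<^sub>1 * \<rho>\<^sub>n * (cmod h\<^sub>n)\<^sup>2) + log 2 (1 + \<beta>\<^sub>2 * \<rho>\<^sub>n * (cmod h\<^sub>n)\<^sup>2))"

text \<open>
  The maximum ranges over an infinite set, so \<^const>\<open>Max\<close> does not apply; \<^const>\<open>Greatest\<close> is the
  greatest element, which exists by \<open>hybrid_rate_attains_max\<close> below.
\<close>

definition R_star :: "real \<Rightarrow> real \<Rightarrow> real \<Rightarrow> real \<Rightarrow> complex \<Rightarrow> complex \<Rightarrow> real" where
  "R_star \<eta> \<rho>\<^sub>n \<rho>\<^sub>m \<epsilon>\<^sub>0 h\<^sub>n h\<^sub>m =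
    (GREATEST r. r \<in> hybrid_rate \<rho>\<^sub>n h\<^sub>n ` hybrid_powers \<eta> \<rho>\<^sub>n \<rho>\<^sub>m \<epsilon>\<^sub>0 h\<^sub>n h\<^sub>m)"

lemma hybrid_rate_attains_max:
  assumes "\<rho>\<^sub>n > 0" "\<eta> > 0"
  shows "\<exists>p \<in> hybrid_powers \<eta> \<rho>\<^sub>n \<rho>\<^sub>m \<epsilon>\<^sub>0 h\<^sub>n h\<^sub>m.
           (\<forall>q \<in> hybrid_powers \<eta> \<rho>\<^sub>n \<rho>\<^sub>m \<epsilon>\<^sub>0 h\<^sub>n h\<^sub>m. hybrid_rate \<rho>\<^sub>n h\<^sub>n q \<le> hybrid_rate \<rho>\<^sub>n h\<^sub>n p) \<and>
           R_star \<eta> \<rho>\<^sub>n \<rho>\<^sub>m \<epsilon>\<^sub>0 h\<^sub>n h\<^sub>m = hybrid_rate \<rho>\<^sub>n h\<^sub>n p"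
proof -
  let ?S = "hybrid_powers \<eta> \<rho>\<^sub>n \<rho>\<^sub>m \<epsilon>\<^sub>0 h\<^sub>n h\<^sub>m" and ?f = "hybrid_rate \<rho>\<^sub>n h\<^sub>n"
  have S: "?S = ({0..1} \<times> {0..1}) \<inter> {p. fst p + snd p \<le> \<eta>} \<inter>
      {p. fst p * \<rho>\<^sub>n * (cmod h\<^sub>n)\<^sup>2 \<le> tau \<rho>\<^sub>m \<epsilon>\<^sub>0 h\<^sub>m}"
    by (auto simp: hybrid_powers_def)
  have "compact ?S"
    unfolding S
    by (intro compact_Int_closed compact_Times compact_Icc closed_Collect_le continuous_intros)
  moreover have "(0, 0) \<in> ?S"
    using assms by (simp add: hybrid_powers_def tau_def)
  hence "?S \<noteq> {}" by blast
  moreover have "continuous_on ?S ?f"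
  proof -
    have pos: "1 + b * \<rho>\<^sub>n * (cmod h\<^sub>n)\<^sup>2 > 0" if "b \<ge> 0" for b
      using that assms by (simp add: add_pos_nonneg)
    have "continuous_on ?S (\<lambda>p. log 2 (1 + fst p * \<rho>\<^sub>n * (cmod h\<^sub>n)\<^sup>2)
        + log 2 (1 + snd p * \<rho>\<^sub>n * (cmod h\<^sub>n)\<^sup>2))"
      unfolding log_def
      by (intro continuous_intros) (force simp: hybrid_powers_def dest: pos)+
    thus ?thesis
      by (simp add: hybrid_rate_def case_prod_beta')
  qed
  ultimately obtain p where p: "p \<in> ?S" "\<forall>q \<in> ?S. ?f q \<le> ?f p"
    using continuous_attains_sup by blast
  have "R_star \<eta> \<rho>\<^sub>n \<rho>\<^sub>m \<epsilon>\<^sub>0 h\<^sub>n h\<^sub>m = ?f p"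
    unfolding R_star_def using p by (intro Greatest_equality) auto
  with p show ?thesis by blast
qed

end

theory Submission imports Defs begin

text \<open>
  Put \<open>a = \<rho>\<^sub>n \<bar>h\<^sub>n\<bar>\<^sup>2\<close>, \<open>s = \<rho>\<^sub>m \<bar>h\<^sub>m\<bar>\<^sup>2 / \<epsilon>\<^sub>0\<close> and \<open>u = \<beta>\<^sub>1 a\<close>. It is optimal to spend the whole power
  budget, so hybrid NOMA beats OMA iff \<open>u (\<eta> a - u) > (1 - \<eta>) a\<close> for some
  \<open>0 \<le> u \<le> max 0 (s - 1)\<close>. This parabola in \<open>u\<close> has its vertex at \<open>\<eta> a / 2\<close>; maximising over the
  interval turns the condition into \<open>s > 1 / \<eta>\<close> together with a lower bound on \<open>a\<close> depending only
  on \<open>s\<close>, with a change of regime at \<open>s = (2 - \<eta>) / \<eta>\<close>. As \<open>\<bar>h\<^sub>n\<bar>\<^sup>2\<close> and \<open>\<bar>h\<^sub>m\<bar>\<^sup>2\<close> are independent and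
  exponentially distributed, the probability of this event is the integral of the exponential tail
  at that bound against the density of \<open>\<bar>h\<^sub>m\<bar>\<^sup>2\<close>.
\<close>

section \<open>Deterministic criterion for hybrid NOMA to beat OMA\<close>

text \<open>For \<open>s > 1 / \<eta>\<close> this is the exact strict lower bound on
  \<open>a\<close>. The first branch is where the vertex value
  \<open>\<eta>\<^sup>2 * a\<^sup>2 / 4\<close> exceeds \<open>(1 - \<eta>) * a\<close>; the second
  is where the value at the endpoint \<open>u = s - 1\<close> does. The branches agree at
  \<open>s = (2 - \<eta>) / \<eta>\<close>.\<close>

definition gain_threshold :: "real \<Rightarrow> real \<Rightarrow> real" where
  "gain_threshold \<eta> s =
     (if (2 - \<eta>) / \<eta> \<le> s then 4 * (1 - \<eta>) / \<eta>\<^sup>2 else (s - 1)\<^sup>2 / (\<eta> * s - 1))"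

lemma gain_threshold_nonneg:
  assumes "0 < \<eta>" "\<eta> \<le> 1" "1 / \<eta> < s"
  shows "gain_threshold \<eta> s \<ge> 0"
  using assms by (auto simp: gain_threshold_def field_simps)

text \<open>The vertex value bounds the parabola for every \<open>u\<close>, which gives the first
  branch of the threshold. When \<open>s < (2 - \<eta>) / \<eta>\<close>, that same bound on
  \<open>a\<close> places \<open>s - 1\<close> left of the vertex, where the parabola increases, so
  the gain at \<open>u\<close> carries over to \<open>s - 1\<close>.\<close>

lemma gain_imp_threshold:
  fixes a s u \<eta> :: real
  assumes \<eta>: "0 < \<eta>" "\<eta> \<le> 1" and a: "a \<ge> 0"
    and u: "0 \<le> u" "u \<le> max 0 (s - 1)" and gain: "(1 - \<eta>) * a < u * (\<eta> * a - u)"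
  shows "1 / \<eta> < s \<and> gain_threshold \<eta> s < a"
proof -
  have nonneg: "(1 - \<eta>) * a \<ge> 0" using \<eta> a by simp
  hence "u \<noteq> 0" using gain by auto
  hence u0: "u > 0" and us: "u \<le> s - 1" using u by auto
  \<comment> \<open>Collecting the terms in \<open>a\<close> leaves a product that must be positive;
    its second factor then forces \<open>\<eta> * s > 1\<close> through
    \<open>u \<le> s - 1\<close>.\<close>
  have eq: "a * (\<eta> * u - 1 + \<eta>) > u\<^sup>2" using gain by (simp add: algebra_simps power2_eq_square)
  hence "a * (\<eta> * u - 1 + \<eta>) > 0" by (smt (verit) zero_le_power2)
  hence a0: "a > 0" and "\<eta> * u - 1 + \<eta> > 0" using a by (auto simp: zero_less_mult_iff)
  moreover have "\<eta> * u \<le> \<eta> * (s - 1)" using \<eta> us by (intro mult_left_mono) auto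
  ultimately have s1: "\<eta> * s > 1" by (simp add: algebra_simps)
  have "0 \<le> (u - \<eta> * a / 2)\<^sup>2" by simp
  hence "(1 - \<eta>) * a < (\<eta>\<^sup>2 * a / 4) * a"
    using gain by (simp add: power2_eq_square algebra_simps)
  hence "1 - \<eta> < \<eta>\<^sup>2 * a / 4" using a0 by (simp only: mult_less_cancel_right_pos)
  hence vertex: "4 * (1 - \<eta>) / \<eta>\<^sup>2 < a" using \<eta> by (simp add: field_simps)
  have "gain_threshold \<eta> s < a"
  proof (cases "(2 - \<eta>) / \<eta> \<le> s")
    case True
    thus ?thesis using vertex by (simp add: gain_threshold_def)
  next
    case False
    have "\<eta> * (s - 1) < 2 * (1 - \<eta>)" using False \<eta> by (simp add: field_simps)
    also have "\<dots> < \<eta> * (\<eta> * a / 2)" using vertex \<eta> by (simp add: field_simps power2_eq_square)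
    finally have "s - 1 < \<eta> * a / 2" using \<eta> by simp
    \<comment> \<open>The product is the parabola at \<open>s - 1\<close> minus the parabola at
      \<open>u\<close>. Its second factor is nonnegative because \<open>u\<close> and
      \<open>s - 1\<close> both lie below \<open>\<eta> * a / 2\<close>.\<close>
    hence "0 \<le> (s - 1 - u) * (\<eta> * a - (s - 1) - u)"
      using us by (intro mult_nonneg_nonneg) auto
    hence "u * (\<eta> * a - u) \<le> (s - 1) * (\<eta> * a - (s - 1))" by (simp add: algebra_simps)
    hence "(s - 1)\<^sup>2 < a * (\<eta> * s - 1)"
      using gain by (simp add: algebra_simps power2_eq_square)
    thus ?thesis using False s1 by (simp add: gain_threshold_def pos_divide_less_eq)
  qed
  thus ?thesis using s1 \<eta> by (simp add: field_simps)
qed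

text \<open>The witness is the vertex \<open>\<eta> * a / 2\<close> in the first regime if it does
  not exceed \<open>s - 1\<close>, and the endpoint \<open>s - 1\<close> otherwise.\<close>

lemma threshold_imp_gain:
  fixes a s \<eta> :: real
  assumes \<eta>: "0 < \<eta>" "\<eta> \<le> 1" and s: "1 / \<eta> < s" and thr: "gain_threshold \<eta> s < a"
  shows "\<exists>u. 0 \<le> u \<and> u \<le> s - 1 \<and> (1 - \<eta>) * a < u * (\<eta> * a - u)"
proof (cases "(2 - \<eta>) / \<eta> \<le> s")
  case True
  have "1 \<le> 1 / \<eta>" using \<eta> by simp
  hence s1: "s > 1" using s by linarith
  have vertex: "4 * (1 - \<eta>) / \<eta>\<^sup>2 < a" using thr True by (simp add: gain_threshold_def)
  moreover have "0 \<le> 4 * (1 - \<eta>) / \<eta>\<^sup>2" using \<eta> by simp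
  ultimately have a0: "a > 0" by linarith
  show ?thesis
  proof (cases "\<eta> * a / 2 \<le> s - 1")
    case le: True
    have "4 * (1 - \<eta>) < a * \<eta>\<^sup>2" using vertex \<eta> by (simp add: pos_divide_less_eq)
    hence "4 * (1 - \<eta>) * a < a * \<eta>\<^sup>2 * a" using a0 by (intro mult_strict_right_mono)
    hence "(1 - \<eta>) * a < \<eta> * a / 2 * (\<eta> * a - \<eta> * a / 2)"
      by (simp add: field_simps power2_eq_square)
    thus ?thesis using le a0 \<eta> by (intro exI[of _ "\<eta> * a / 2"]) auto
  next
    case gt: False
    \<comment> \<open>The regime bound on \<open>s\<close> already makes
      \<open>(s - 1) * (\<eta> * a / 2)\<close> large enough; since \<open>s - 1\<close> is below
      the vertex, the factor \<open>\<eta> * a - (s - 1)\<close> is larger still than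
      \<open>\<eta> * a / 2\<close>.\<close>
    have "2 * (1 - \<eta>) \<le> (s - 1) * \<eta>" using True \<eta> by (simp add: field_simps)
    hence "2 * (1 - \<eta>) * a \<le> (s - 1) * \<eta> * a" using a0 by (intro mult_right_mono) auto
    hence "(1 - \<eta>) * a \<le> (s - 1) * (\<eta> * a / 2)" by (simp add: mult_ac)
    also have "(s - 1) * (\<eta> * a / 2) < (s - 1) * (\<eta> * a - (s - 1))"
      using gt s1 by (intro mult_strict_left_mono) auto
    finally show ?thesis using s1 by (intro exI[of _ "s - 1"]) auto
  qed
next
  case False
  have "1 \<le> 1 / \<eta>" using \<eta> by simp
  hence s1: "s > 1" using s by linarith
  have "\<eta> * s > 1" using s \<eta> by (simp add: field_simps)
  hence "(s - 1)\<^sup>2 < a * (\<eta> * s - 1)"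
    using thr False by (simp add: gain_threshold_def pos_divide_less_eq)
  hence "(1 - \<eta>) * a < (s - 1) * (\<eta> * a - (s - 1))"
    by (simp add: algebra_simps power2_eq_square)
  thus ?thesis using s1 by (intro exI[of _ "s - 1"]) auto
qed

text \<open>The maximum is attained, so the rates can be compared at single power pairs, where
  taking logarithms away leaves \<open>(1 + b * a) * (1 + c * a) \<le> 1 + a\<close>. With
  \<open>c = \<eta> - b\<close> and \<open>u = b * a\<close> the left side is
  \<open>1 + \<eta> * a + u * (\<eta> * a - u)\<close>, so failure of the inequality is exactly the
  gain condition.\<close>

lemma R_star_le_R_OMA_iff:
  assumes \<rho>: "\<rho>\<^sub>n > 0" and \<eta>: "0 < \<eta>" "\<eta> \<le> 1"
  shows "R_star \<eta> \<rho>\<^sub>n \<rho>\<^sub>m \<epsilon>\<^sub>0 h\<^sub>n h\<^sub>m \<le> R_OMA \<rho>\<^sub>n h\<^sub>n \<longleftrightarrow>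
    \<not> (1 / \<eta> < \<rho>\<^sub>m * (cmod h\<^sub>m)\<^sup>2 / \<epsilon>\<^sub>0 \<and>
       gain_threshold \<eta> (\<rho>\<^sub>m * (cmod h\<^sub>m)\<^sup>2 / \<epsilon>\<^sub>0) < \<rho>\<^sub>n * (cmod h\<^sub>n)\<^sup>2)"
proof -
  define a where "a = \<rho>\<^sub>n * (cmod h\<^sub>n)\<^sup>2"
  define s where "s = \<rho>\<^sub>m * (cmod h\<^sub>m)\<^sup>2 / \<epsilon>\<^sub>0"
  have a: "a \<ge> 0" using \<rho> by (simp add: a_def)
  have rate: "hybrid_rate \<rho>\<^sub>n h\<^sub>n (b, c) \<le> R_OMA \<rho>\<^sub>n h\<^sub>n \<longleftrightarrow> (1 + b * a) * (1 + c * a) \<le> 1 + a"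
    if "b \<ge> 0" "c \<ge> 0" for b c
  proof -
    have pos: "1 + b * a > 0" "1 + c * a > 0" "1 + a > 0"
      using that a by (auto intro: add_pos_nonneg)
    have "hybrid_rate \<rho>\<^sub>n h\<^sub>n (b, c) = log 2 ((1 + b * a) * (1 + c * a))"
      using pos by (simp add: hybrid_rate_def a_def log_mult mult.assoc)
    thus ?thesis using pos by (simp add: R_OMA_def a_def)
  qed
  have mem: "(b, c) \<in> hybrid_powers \<eta> \<rho>\<^sub>n \<rho>\<^sub>m \<epsilon>\<^sub>0 h\<^sub>n h\<^sub>m \<longleftrightarrow>
      b \<in> {0..1} \<and> c \<in> {0..1} \<and> b + c \<le> \<eta> \<and> b * a \<le> max 0 (s - 1)" for b c
    by (simp add: hybrid_powers_def tau_def a_def s_def mult.assoc)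
  obtain p where p: "p \<in> hybrid_powers \<eta> \<rho>\<^sub>n \<rho>\<^sub>m \<epsilon>\<^sub>0 h\<^sub>n h\<^sub>m"
      "\<forall>q \<in> hybrid_powers \<eta> \<rho>\<^sub>n \<rho>\<^sub>m \<epsilon>\<^sub>0 h\<^sub>n h\<^sub>m. hybrid_rate \<rho>\<^sub>n h\<^sub>n q \<le> hybrid_rate \<rho>\<^sub>n h\<^sub>n p"
      "R_star \<eta> \<rho>\<^sub>n \<rho>\<^sub>m \<epsilon>\<^sub>0 h\<^sub>n h\<^sub>m = hybrid_rate \<rho>\<^sub>n h\<^sub>n p"
    using hybrid_rate_attains_max[OF \<rho> \<eta>(1)] by blast
  have "R_star \<eta> \<rho>\<^sub>n \<rho>\<^sub>m \<epsilon>\<^sub>0 h\<^sub>n h\<^sub>m \<le> R_OMA \<rho>\<^sub>n h\<^sub>n \<longleftrightarrow> \<not> (1 / \<eta> < s \<and> gain_threshold \<eta> s < a)"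
  proof
    assume le: "R_star \<eta> \<rho>\<^sub>n \<rho>\<^sub>m \<epsilon>\<^sub>0 h\<^sub>n h\<^sub>m \<le> R_OMA \<rho>\<^sub>n h\<^sub>n"
    show "\<not> (1 / \<eta> < s \<and> gain_threshold \<eta> s < a)"
    proof
      assume s: "1 / \<eta> < s \<and> gain_threshold \<eta> s < a"
      then obtain u where u: "0 \<le> u" "u \<le> s - 1" "(1 - \<eta>) * a < u * (\<eta> * a - u)"
        using threshold_imp_gain[OF \<eta>] by blast
      have a0: "a > 0" using gain_threshold_nonneg[OF \<eta>] s by force
      have "(1 - \<eta>) * a \<ge> 0" using \<eta> a by simp
      hence "u * (\<eta> * a - u) > 0" using u by linarith
      \<comment> \<open>This makes the remaining power fraction \<open>\<eta> - u / a\<close>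
        nonnegative, so that the pair built from \<open>u\<close> is admissible.\<close>
      hence "u < \<eta> * a" using u by (auto simp: zero_less_mult_iff)
      hence "u / a \<le> \<eta>" using a0 by (simp add: field_simps)
      moreover from this have "u / a \<le> 1" using \<eta> by linarith
      moreover have "u / a \<ge> 0" using u a0 by simp
      moreover from this have "\<eta> - u / a \<le> 1" using \<eta> by linarith
      ultimately have mem': "(u / a, \<eta> - u / a) \<in> hybrid_powers \<eta> \<rho>\<^sub>n \<rho>\<^sub>m \<epsilon>\<^sub>0 h\<^sub>n h\<^sub>m"
        using u a0 \<eta> by (auto simp: mem)
      hence "hybrid_rate \<rho>\<^sub>n h\<^sub>n (u / a, \<eta> - u / a) \<le> R_OMA \<rho>\<^sub>n h\<^sub>n" using p le by force
      hence "(1 + u / a * a) * (1 + (\<eta> - u / a) * a) \<le> 1 + a"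
        using mem' by (subst (asm) rate) (auto simp: mem)
      thus False using u a0 by (simp add: algebra_simps)
    qed
  next
    assume no: "\<not> (1 / \<eta> < s \<and> gain_threshold \<eta> s < a)"
    obtain b c where bc: "p = (b, c)" by (cases p)
    hence b: "b \<ge> 0" "c \<ge> 0" "b + c \<le> \<eta>" "b * a \<le> max 0 (s - 1)" using p(1) by (auto simp: mem)
    have "b * a * (\<eta> * a - b * a) \<le> (1 - \<eta>) * a"
      using gain_imp_threshold[OF \<eta> a, of "b * a" s] no b a by force
    \<comment> \<open>Raising the second power fraction to exhaust the budget can only increase the
      product.\<close>
    moreover have "(1 + b * a) * (1 + c * a) \<le> (1 + b * a) * (1 + (\<eta> - b) * a)"
      using b a by (intro mult_left_mono add_mono mult_right_mono) auto
    ultimately have "(1 + b * a) * (1 + c * a) \<le> 1 + a" by (simp add: algebra_simps)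
    thus "R_star \<eta> \<rho>\<^sub>n \<rho>\<^sub>m \<epsilon>\<^sub>0 h\<^sub>n h\<^sub>m \<le> R_OMA \<rho>\<^sub>n h\<^sub>n" using p(3) bc b rate by simp
  qed
  thus ?thesis by (simp add: a_def s_def)
qed

section \<open>Squared modulus of a complex Gaussian\<close>

text \<open>A disc of radius \<open>sqrt t\<close> has area \<open>pi * t\<close>, and the sets
  \<open>{..t}\<close> form an intersection-stable generator of the Borel sets. This replaces a
  change to polar coordinates.\<close>

lemma distr_lborel_cmod_square:
  "distr lborel borel (\<lambda>z::complex. (cmod z)\<^sup>2) = density lborel (\<lambda>x. ennreal pi * indicator {0..} x)"
proof (rule measure_eqI_generator_eq[where E = "range atMost" and \<Omega> = UNIV and A = "\<lambda>n. {..real n}"])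
  have area: "emeasure (distr lborel borel (\<lambda>z::complex. (cmod z)\<^sup>2)) {..t} = ennreal (pi * max 0 t)" for t
  proof (cases "t \<ge> 0")
    case True
    have "(cmod z)\<^sup>2 \<le> t \<longleftrightarrow> cmod z \<le> sqrt t" for z
      using abs_le_square_iff[of "cmod z" "sqrt t"] True by simp
    hence "(\<lambda>z::complex. (cmod z)\<^sup>2) -` {..t} = cball 0 (sqrt t)" by auto
    thus ?thesis using True by (simp add: emeasure_distr emeasure_cball unit_ball_vol_2)
  next
    case False
    hence "\<not> (cmod z)\<^sup>2 \<le> t" for z using zero_le_power2[of "cmod z"] by linarith
    hence "(\<lambda>z::complex. (cmod z)\<^sup>2) -` {..t} = {}" by auto
    thus ?thesis using False by (simp add: emeasure_distr max_def)
  qed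
  show "emeasure (distr lborel borel (\<lambda>z::complex. (cmod z)\<^sup>2)) X =
      emeasure (density lborel (\<lambda>x. ennreal pi * indicator {0..} x)) X" if "X \<in> range atMost" for X
  proof -
    from that obtain t where X: "X = {..t}" by auto
    have "emeasure (density lborel (\<lambda>x. ennreal pi * indicator {0..} x)) {..t} =
        (\<integral>\<^sup>+x. ennreal pi * indicator {0..t} x \<partial>lborel)"
      by (subst emeasure_density) (auto intro!: nn_integral_cong split: split_indicator)
    also have "\<dots> = ennreal (pi * max 0 t)"
      by (subst nn_integral_cmult_indicator) (auto simp: ennreal_mult' max_def emeasure_lborel_Icc_eq)
    finally show ?thesis using area X by simp
  qed
  show "emeasure (distr lborel borel (\<lambda>z::complex. (cmod z)\<^sup>2)) {..real n} \<noteq> \<infinity>" for n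
    by (simp add: area)
  show "(\<Union>i. {..real i}) = UNIV" by (auto intro: real_arch_simple)
  show "sets (distr lborel borel (\<lambda>z::complex. (cmod z)\<^sup>2)) = sigma_sets UNIV (range atMost)"
    "sets (density lborel (\<lambda>x. ennreal pi * indicator {0..} x)) = sigma_sets UNIV (range (atMost :: real \<Rightarrow> _))"
    by (simp_all add: borel_eq_atMost)
qed (auto simp: Int_stable_def)

text \<open>The Gaussian density depends on \<open>z\<close> only through its squared modulus, so it
  can be pushed forward as a function \<open>g\<close> of that variable; the area factor
  \<open>pi\<close> cancels its \<open>1 / pi\<close>.\<close>

lemma distributed_cmod_square:
  assumes "distributed M lborel h (\<lambda>z. ennreal (complex_normal_density 0 1 z))"
  shows "distributed M lborel (\<lambda>\<omega>. (cmod (h \<omega>))\<^sup>2) (exponential_density 1)"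
  unfolding distributed_def
proof (intro conjI)
  have h[measurable]: "h \<in> borel_measurable M" using assms by (simp add: distributed_def)
  show "(\<lambda>\<omega>. (cmod (h \<omega>))\<^sup>2) \<in> measurable M lborel" by simp
  show "(\<lambda>x. ennreal (exponential_density 1 x)) \<in> borel_measurable lborel" by simp
  define g where "g x = ennreal (exp (- x) / pi)" for x :: real
  have [measurable]: "g \<in> borel_measurable borel" unfolding g_def by measurable
  have "distr M lborel (\<lambda>\<omega>. (cmod (h \<omega>))\<^sup>2) = distr (distr M lborel h) borel (\<lambda>z. (cmod z)\<^sup>2)"
    by (subst distr_distr) (auto simp: comp_def intro!: distr_cong)
  also have "distr M lborel h = density lborel (\<lambda>z. g ((cmod z)\<^sup>2))"
    using assms by (simp add: distributed_def complex_normal_density_def g_def)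
  also have "distr \<dots> borel (\<lambda>z. (cmod z)\<^sup>2) = density (distr lborel borel (\<lambda>z. (cmod z)\<^sup>2)) g"
    by (rule density_distr[symmetric]) auto
  also have "\<dots> = density lborel (\<lambda>x. ennreal pi * indicator {0..} x * g x)"
    unfolding distr_lborel_cmod_square by (rule density_density_eq) auto
  also have "\<dots> = density lborel (\<lambda>x. ennreal (exponential_density 1 x))"
    by (intro density_cong AE_I2)
       (auto simp: exponential_density_def g_def ennreal_mult'[symmetric] split: split_indicator)
  finally show "distr M lborel (\<lambda>\<omega>. (cmod (h \<omega>))\<^sup>2) = density lborel (\<lambda>x. ennreal (exponential_density 1 x))" .
qed

section \<open>Tail probability above a random threshold\<close>

text \<open>Independence turns the joint law into a product, and Fubini integrates the sections over
  \<open>y\<close>. For \<open>y\<close> in \<open>S\<close> the section is the ray above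
  \<open>c y\<close>; nonnegativity of \<open>c y\<close> makes its mass \<open>exp (- c y)\<close>,
  and nonnegativity of \<open>y\<close> makes the density of \<open>Y\<close> equal to
  \<open>exp (- y)\<close>.\<close>

lemma (in prob_space) emeasure_exponential_above_threshold:
  assumes indep: "indep_var borel X borel Y"
    and X: "distributed M lborel X (exponential_density 1)"
    and Y: "distributed M lborel Y (exponential_density 1)"
    and [measurable]: "c \<in> borel_measurable borel" "S \<in> sets borel"
    and S: "\<And>y. y \<in> S \<Longrightarrow> 0 \<le> y \<and> 0 \<le> c y"
  shows "emeasure M {\<omega> \<in> space M. Y \<omega> \<in> S \<and> c (Y \<omega>) < X \<omega>} =
    (\<integral>\<^sup>+y. ennreal (exp (- y) * exp (- c y)) * indicator S y \<partial>lborel)"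
proof -
  have [measurable]: "X \<in> borel_measurable M" "Y \<in> borel_measurable M"
    using X Y by (auto simp: distributed_def)
  interpret X: prob_space "distr M borel X" by (rule prob_space_distr) simp
  interpret Y: prob_space "distr M borel Y" by (rule prob_space_distr) simp
  interpret XY: pair_sigma_finite "distr M borel X" "distr M borel Y" ..
  define B where "B = {p \<in> space (borel \<Otimes>\<^sub>M borel :: (real \<times> real) measure). snd p \<in> S \<and> c (snd p) < fst p}"
  have B[measurable]: "B \<in> sets (borel \<Otimes>\<^sub>M borel)"
    unfolding B_def by measurable
  have pair: "distr M borel X \<Otimes>\<^sub>M distr M borel Y = distr M (borel \<Otimes>\<^sub>M borel) (\<lambda>\<omega>. (X \<omega>, Y \<omega>))"
    using indep by (simp add: indep_var_distribution_eq)
  have "{\<omega> \<in> space M. Y \<omega> \<in> S \<and> c (Y \<omega>) < X \<omega>} = (\<lambda>\<omega>. (X \<omega>, Y \<omega>)) -` B \<inter> space M"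
    by (auto simp: B_def space_pair_measure)
  hence "emeasure M {\<omega> \<in> space M. Y \<omega> \<in> S \<and> c (Y \<omega>) < X \<omega>} =
      emeasure (distr M borel X \<Otimes>\<^sub>M distr M borel Y) B"
    unfolding pair by (simp add: emeasure_distr)
  also have "\<dots> = (\<integral>\<^sup>+y. emeasure (distr M borel X) ((\<lambda>x. (x, y)) -` B) \<partial>distr M borel Y)"
    by (rule XY.emeasure_pair_measure_alt2) simp
  also have "\<dots> = (\<integral>\<^sup>+y. ennreal (exp (- c y)) * indicator S y \<partial>distr M borel Y)"
  proof (rule nn_integral_cong)
    fix y
    show "emeasure (distr M borel X) ((\<lambda>x. (x, y)) -` B) = ennreal (exp (- c y)) * indicator S y"
    proof (cases "y \<in> S")
      case True
      hence "(\<lambda>x. (x, y)) -` B = {c y<..}" by (auto simp: B_def space_pair_measure)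
      hence "emeasure (distr M borel X) ((\<lambda>x. (x, y)) -` B) = emeasure M {\<omega> \<in> space M. c y < X \<omega>}"
        by (auto simp: emeasure_distr intro!: arg_cong[where f = "emeasure M"])
      also have "\<dots> = ennreal (exp (- c y))"
        using exponential_distributedD_gt[OF X, of "c y"] S[OF True] by (simp add: emeasure_eq_measure)
      finally show ?thesis using True by simp
    qed (simp add: B_def)
  qed
  also have "distr M borel Y = distr M lborel Y" by (rule distr_cong) auto
  also have "\<dots> = density lborel (exponential_density 1)"
    using Y by (simp add: distributed_def)
  also have "(\<integral>\<^sup>+y. ennreal (exp (- c y)) * indicator S y \<partial>density lborel (exponential_density 1)) =
      (\<integral>\<^sup>+y. ennreal (exp (- y) * exp (- c y)) * indicator S y \<partial>lborel)"
    by (subst nn_integral_density)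
       (auto intro!: nn_integral_cong simp: S leD exponential_density_def ennreal_mult' split: split_indicator)
  finally show ?thesis .
qed

section \<open>Evaluation of the probability\<close>

theorem lemma2:
  fixes M :: "'a measure" and h\<^sub>n h\<^sub>m :: "'a \<Rightarrow> complex"
    and \<rho>\<^sub>n \<rho>\<^sub>m R\<^sub>0 \<epsilon>\<^sub>0 \<eta> :: real
  assumes "prob_space M"
    and "\<rho>\<^sub>n > 0" and "\<rho>\<^sub>m > 0" and "R\<^sub>0 > 0"
    and "\<epsilon>\<^sub>0 = 2 powr R\<^sub>0 - 1"
    and "0 < \<eta>" and "\<eta> \<le> 1"
    and "prob_space.indep_var M borel h\<^sub>n borel h\<^sub>m"
    and "distributed M lborel h\<^sub>n (\<lambda>z. ennreal (complex_normal_density 0 1 z))"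
    and "distributed M lborel h\<^sub>m (\<lambda>z. ennreal (complex_normal_density 0 1 z))"
  shows "\<P>(\<omega> in M. R_star \<eta> \<rho>\<^sub>n \<rho>\<^sub>m \<epsilon>\<^sub>0 (h\<^sub>n \<omega>) (h\<^sub>m \<omega>) \<le> R_OMA \<rho>\<^sub>n (h\<^sub>n \<omega>)) =
    1 - exp (- ((2 - \<eta>) * \<epsilon>\<^sub>0) / (\<eta> * \<rho>\<^sub>m) - (4 * (1 - \<eta>)) / (\<eta>\<^sup>2 * \<rho>\<^sub>n))
      - (LBINT y:{\<epsilon>\<^sub>0 / (\<eta> * \<rho>\<^sub>m)..((2 - \<eta>) * \<epsilon>\<^sub>0) / (\<eta> * \<rho>\<^sub>m)}.
           exp (- y) * exp (- ((\<rho>\<^sub>m / \<epsilon>\<^sub>0 * y - 1)\<^sup>2 / (\<rho>\<^sub>n * (\<eta> * \<rho>\<^sub>m / \<epsilon>\<^sub>0 * y - 1)))))"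
proof -
  interpret prob_space M by fact
  note \<rho>\<^sub>n = \<open>\<rho>\<^sub>n > 0\<close> and \<rho>\<^sub>m = \<open>\<rho>\<^sub>m > 0\<close> and \<eta> = \<open>0 < \<eta>\<close> \<open>\<eta> \<le> 1\<close>
  have \<epsilon>: "\<epsilon>\<^sub>0 > 0" using \<open>R\<^sub>0 > 0\<close> \<open>\<epsilon>\<^sub>0 = _\<close> by simp
  define X where "X = (\<lambda>\<omega>. (cmod (h\<^sub>n \<omega>))\<^sup>2)"
  define Y where "Y = (\<lambda>\<omega>. (cmod (h\<^sub>m \<omega>))\<^sup>2)"
  \<comment> \<open>\<open>y0\<close> and \<open>y1\<close> are the values of \<open>Y\<close> at
    which \<open>s\<close> reaches \<open>1 / \<eta>\<close> and
    \<open>(2 - \<eta>) / \<eta>\<close>. \<open>K\<close> and \<open>d\<close> are the two branches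
    of the threshold divided by \<open>\<rho>\<^sub>n\<close>, hence bounds on \<open>X\<close>
    itself.\<close>
  define y0 where "y0 = \<epsilon>\<^sub>0 / (\<eta> * \<rho>\<^sub>m)"
  define y1 where "y1 = ((2 - \<eta>) * \<epsilon>\<^sub>0) / (\<eta> * \<rho>\<^sub>m)"
  define K where "K = (4 * (1 - \<eta>)) / (\<eta>\<^sup>2 * \<rho>\<^sub>n)"
  define d where "d y = (\<rho>\<^sub>m / \<epsilon>\<^sub>0 * y - 1)\<^sup>2 / (\<rho>\<^sub>n * (\<eta> * \<rho>\<^sub>m / \<epsilon>\<^sub>0 * y - 1))" for y
  define c where "c y = gain_threshold \<eta> (\<rho>\<^sub>m * y / \<epsilon>\<^sub>0) / \<rho>\<^sub>n" for y
  have X: "distributed M lborel X (exponential_density 1)"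
    and Y: "distributed M lborel Y (exponential_density 1)"
    unfolding X_def Y_def using assms by (auto intro: distributed_cmod_square)
  have [measurable]: "X \<in> borel_measurable M" "Y \<in> borel_measurable M"
    using X Y by (auto simp: distributed_def)
  have "indep_var borel ((\<lambda>z. (cmod z)\<^sup>2) \<circ> h\<^sub>n) borel ((\<lambda>z. (cmod z)\<^sup>2) \<circ> h\<^sub>m)"
    using \<open>indep_var borel h\<^sub>n borel h\<^sub>m\<close> by (rule indep_var_compose) auto
  hence indep: "indep_var borel X borel Y" by (simp add: X_def Y_def comp_def)
  have y0_pos: "0 < y0" using \<epsilon> \<eta> \<rho>\<^sub>m by (simp add: y0_def)
  have y0_le: "y0 \<le> y1" using \<epsilon> \<eta> \<rho>\<^sub>m by (simp add: y0_def y1_def divide_simps)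
  have y0_iff: "1 / \<eta> < \<rho>\<^sub>m * y / \<epsilon>\<^sub>0 \<longleftrightarrow> y0 < y"
    and y1_iff: "(2 - \<eta>) / \<eta> \<le> \<rho>\<^sub>m * y / \<epsilon>\<^sub>0 \<longleftrightarrow> y1 \<le> y" for y
    using \<epsilon> \<eta> \<rho>\<^sub>m by (auto simp: y0_def y1_def field_simps)
  have c_eq: "c y = (if y1 \<le> y then K else d y)" for y
    by (simp add: c_def gain_threshold_def y1_iff K_def d_def mult_ac)
  have [measurable]: "d \<in> borel_measurable borel" unfolding d_def by measurable
  have [measurable]: "c \<in> borel_measurable borel" unfolding c_eq by measurable
  have c_nonneg: "0 \<le> c y" if "y0 < y" for y
    using gain_threshold_nonneg[OF \<eta>, of "\<rho>\<^sub>m * y / \<epsilon>\<^sub>0"] that \<rho>\<^sub>n by (simp add: c_def y0_iff)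

  \<comment> \<open>\<open>G\<close> is the event that hybrid NOMA strictly beats OMA.\<close>
  define G where "G = {\<omega> \<in> space M. Y \<omega> \<in> {y0<..} \<and> c (Y \<omega>) < X \<omega>}"
  have [measurable]: "G \<in> events" unfolding G_def by measurable
  have "{\<omega> \<in> space M. R_star \<eta> \<rho>\<^sub>n \<rho>\<^sub>m \<epsilon>\<^sub>0 (h\<^sub>n \<omega>) (h\<^sub>m \<omega>) \<le> R_OMA \<rho>\<^sub>n (h\<^sub>n \<omega>)} = space M - G"
    using \<rho>\<^sub>n unfolding R_star_le_R_OMA_iff[OF \<rho>\<^sub>n \<eta>] y0_iff
    by (auto simp: G_def X_def Y_def c_def pos_divide_less_eq mult.commute)
  hence compl: "\<P>(\<omega> in M. R_star \<eta> \<rho>\<^sub>n \<rho>\<^sub>m \<epsilon>\<^sub>0 (h\<^sub>n \<omega>) (h\<^sub>m \<omega>) \<le> R_OMA \<rho>\<^sub>n (h\<^sub>n \<omega>)) = 1 - prob G"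
    by (simp add: prob_compl)

  define A where "A = (\<integral>\<^sup>+y. ennreal (exp (- y) * exp (- d y)) * indicator {y0..y1} y \<partial>lborel)"
  have "emeasure M G = (\<integral>\<^sup>+y. ennreal (exp (- y) * exp (- c y)) * indicator {y0<..} y \<partial>lborel)"
    unfolding G_def using c_nonneg y0_pos
    by (intro emeasure_exponential_above_threshold[OF indep X Y]) auto
  \<comment> \<open>Beyond \<open>y1\<close> the threshold is the constant \<open>K\<close>, which
    factors out. The equality is only almost everywhere: both indicators contain \<open>y1\<close>,
    and \<open>y0\<close>, where the denominator of \<open>d\<close> vanishes, is outside the open
    ray.\<close>
  also have "\<dots> = (\<integral>\<^sup>+y. ennreal (exp (- y) * exp (- d y)) * indicator {y0..y1} y +
      ennreal (exp (- K)) * (ennreal (exp (- y)) * indicator {y1..} y) \<partial>lborel)"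
  proof (rule nn_integral_cong_AE)
    show "AE y in lborel. ennreal (exp (- y) * exp (- c y)) * indicator {y0<..} y =
        ennreal (exp (- y) * exp (- d y)) * indicator {y0..y1} y +
        ennreal (exp (- K)) * (ennreal (exp (- y)) * indicator {y1..} y)"
      using AE_lborel_singleton[of y0] AE_lborel_singleton[of y1]
      by eventually_elim
        (use y0_le in \<open>auto simp: c_eq ennreal_mult' mult.commute split: split_indicator\<close>)
  qed
  also have "\<dots> = A + ennreal (exp (- K)) * (\<integral>\<^sup>+y. ennreal (exp (- y)) * indicator {y1..} y \<partial>lborel)"
    unfolding A_def by (subst nn_integral_add) (auto simp: nn_integral_cmult)
  also have "(\<integral>\<^sup>+y. ennreal (exp (- y)) * indicator {y1..} y \<partial>lborel) = ennreal (0 - - exp (- y1))"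
  proof (rule nn_integral_FTC_atLeast)
    have "((\<lambda>y::real. - exp (- y)) \<longlongrightarrow> - 0) at_top"
      by (intro tendsto_minus filterlim_compose[OF exp_at_bot] filterlim_uminus_at_bot_at_top)
    thus "((\<lambda>y::real. - exp (- y)) \<longlongrightarrow> 0) at_top" by simp
  qed (auto intro!: derivative_eq_intros)
  also have "ennreal (exp (- K)) * ennreal (0 - - exp (- y1)) = ennreal (exp (- y1 - K))"
    by (simp add: ennreal_mult'[symmetric] exp_add[symmetric] add.commute)
  finally have G: "emeasure M G = A + ennreal (exp (- y1 - K))" .
  \<comment> \<open>Finiteness of \<open>A\<close> is what allows \<open>enn2real\<close> to be
    split over the sum.\<close>
  have "A \<le> emeasure M G" by (simp add: G)
  hence "A < top" using emeasure_finite[of G] by (auto simp: less_top[symmetric] top_unique)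
  hence "prob G = enn2real A + exp (- y1 - K)"
    by (simp add: measure_def G enn2real_plus)
  moreover have "enn2real A = (LBINT y:{y0..y1}. exp (- y) * exp (- d y))"
    unfolding A_def set_lebesgue_integral_def
    by (subst integral_eq_nn_integral)
       (auto intro!: arg_cong[where f = enn2real] nn_integral_cong split: split_indicator)
  ultimately show ?thesis
    using compl by (simp add: y0_def y1_def K_def d_def)
qed

end
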